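(* Let $\mathcal{A}$ be a $C^*$-algebra and $X$ a Stone space. A positive map $\phi\colon C(X)\to\mathcal{A}$ is $\sigma$-normal if and only if it is $\sigma$-additive on projections, i.e. for every sequence $(p_n)$ of pairwise orthogonal projections in $C(X)$ for which the infinite sum $\sum_n p_n$ exists in $C(X)$, one has $\phi(\sum_n p_n)=\sum_n\phi(p_n)$ (meaning the latter sum exists in $\mathcal{A}$ and equals the former).
   Context: All $C^*$-algebras are unital. A positive map $\phi\colon\mathcal{A}\to\mathcal{B}$ between $C^*$-algebras is $\sigma$-normal if $\phi(\sup_n a_n)=\sup_n\phi(a_n)$ for every norm-bounded monotone increasing sequence $(a_n)$ of self-adjoint elements whose supremum exists in $\mathcal{A}$ (supremum in the poset of self-adjoint elements). For a family $(a_i)_{i\in I}$ of positive elements in a $C^*$-algebra, its infinite sum $\sum_i a_i$ is the supremum (in the self-adjoint poset) of all finite partial sums, when it exists. This sum in $C(X)$ need not be the pointwise sum. *)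

theory Defs
  imports "HOL-Analysis.Analysis"
begin

class cstar_algebra = banach + real_normed_algebra + ring_1 +
  fixes scaleC :: "complex \<Rightarrow> 'a \<Rightarrow> 'a"
    and cstar :: "'a \<Rightarrow> 'a"
  assumes scaleC_add_right: "scaleC c (a + b) = scaleC c a + scaleC c b"
    and scaleC_add_left: "scaleC (c + d) a = scaleC c a + scaleC d a"
    and scaleC_scaleC: "scaleC c (scaleC d a) = scaleC (c * d) a"
    and scaleC_one: "scaleC 1 a = a"
    and scaleR_scaleC: "scaleR r a = scaleC (complex_of_real r) a"
    and scaleC_mult_left: "scaleC c a * b = scaleC c (a * b)"
    and scaleC_mult_right: "a * scaleC c b = scaleC c (a * b)"
    and norm_scaleC: "norm (scaleC c a) = cmod c * norm a"
    and cstar_cstar: "cstar (cstar a) = a"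
    and cstar_add: "cstar (a + b) = cstar a + cstar b"
    and cstar_scaleC: "cstar (scaleC c a) = scaleC (cnj c) (cstar a)"
    and cstar_mult: "cstar (a * b) = cstar b * cstar a"
    and cstar_identity: "norm (cstar a * a) = (norm a)\<^sup>2"

definition sa_el :: "'b set \<Rightarrow> ('b \<Rightarrow> 'b) \<Rightarrow> 'b \<Rightarrow> bool" where
  "sa_el S st a \<longleftrightarrow> a \<in> S \<and> st a = a"

definition pos_el :: "'b set \<Rightarrow> ('b \<Rightarrow> 'b) \<Rightarrow> ('b \<Rightarrow> 'b \<Rightarrow> 'b) \<Rightarrow> 'b \<Rightarrow> bool" where
  "pos_el S st mul a \<longleftrightarrow> a \<in> S \<and> (\<exists>b\<in>S. a = mul (st b) b)"

definition sa_le :: "'b::minus set \<Rightarrow> ('b \<Rightarrow> 'b) \<Rightarrow> ('b \<Rightarrow> 'b \<Rightarrow> 'b) \<Rightarrow> 'b \<Rightarrow> 'b \<Rightarrow> bool" where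
  "sa_le S st mul a b \<longleftrightarrow> sa_el S st a \<and> sa_el S st b \<and> pos_el S st mul (b - a)"

definition is_sup_sa :: "'b::minus set \<Rightarrow> ('b \<Rightarrow> 'b) \<Rightarrow> ('b \<Rightarrow> 'b \<Rightarrow> 'b) \<Rightarrow> 'b set \<Rightarrow> 'b \<Rightarrow> bool" where
  "is_sup_sa S st mul T s \<longleftrightarrow>
     sa_el S st s \<and> (\<forall>t\<in>T. sa_le S st mul t s) \<and>
     (\<forall>u. sa_el S st u \<and> (\<forall>t\<in>T. sa_le S st mul t u) \<longrightarrow> sa_le S st mul s u)"

definition CX :: "'x topology \<Rightarrow> ('x \<Rightarrow> complex) set" where
  "CX X = {f. continuous_map X euclidean f \<and> (\<forall>x. x \<notin> topspace X \<longrightarrow> f x = 0)}"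

definition cx_star :: "('x \<Rightarrow> complex) \<Rightarrow> ('x \<Rightarrow> complex)" where
  "cx_star f = (\<lambda>x. cnj (f x))"

definition cx_mult :: "('x \<Rightarrow> complex) \<Rightarrow> ('x \<Rightarrow> complex) \<Rightarrow> ('x \<Rightarrow> complex)" where
  "cx_mult f g = (\<lambda>x. f x * g x)"

definition stone_space :: "'x topology \<Rightarrow> bool" where
  "stone_space X \<longleftrightarrow> compact_space X \<and> Hausdorff_space X \<and>
     (\<forall>S. connectedin X S \<longrightarrow> (\<exists>a. S \<subseteq> {a}))"

definition positive_map :: "'x topology \<Rightarrow> (('x \<Rightarrow> complex) \<Rightarrow> 'a::cstar_algebra) \<Rightarrow> bool" where
  "positive_map X \<phi> \<longleftrightarrow>
     (\<forall>f\<in>CX X. \<forall>g\<in>CX X. \<phi> (\<lambda>x. f x + g x) = \<phi> f + \<phi> g) \<and>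
     (\<forall>f\<in>CX X. \<forall>c. \<phi> (\<lambda>x. c * f x) = scaleC c (\<phi> f)) \<and>
     (\<forall>f. pos_el (CX X) cx_star cx_mult f \<longrightarrow> pos_el UNIV cstar (*) (\<phi> f))"

definition sigma_normal :: "'x topology \<Rightarrow> (('x \<Rightarrow> complex) \<Rightarrow> 'a::cstar_algebra) \<Rightarrow> bool" where
  "sigma_normal X \<phi> \<longleftrightarrow>
     (\<forall>a :: nat \<Rightarrow> ('x \<Rightarrow> complex). \<forall>s.
        (\<forall>n. sa_el (CX X) cx_star (a n)) \<and>
        (\<exists>B. \<forall>n. \<forall>x\<in>topspace X. cmod (a n x) \<le> B) \<and>
        (\<forall>n. sa_le (CX X) cx_star cx_mult (a n) (a (Suc n))) \<and>
        is_sup_sa (CX X) cx_star cx_mult (range a) s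
      \<longrightarrow> is_sup_sa UNIV cstar (*) (range (\<lambda>n. \<phi> (a n))) (\<phi> s))"

definition is_projection :: "'b set \<Rightarrow> ('b \<Rightarrow> 'b) \<Rightarrow> ('b \<Rightarrow> 'b \<Rightarrow> 'b) \<Rightarrow> 'b \<Rightarrow> bool" where
  "is_projection S st mul p \<longleftrightarrow> p \<in> S \<and> st p = p \<and> mul p p = p"

definition sigma_additive_proj :: "'x topology \<Rightarrow> (('x \<Rightarrow> complex) \<Rightarrow> 'a::cstar_algebra) \<Rightarrow> bool" where
  "sigma_additive_proj X \<phi> \<longleftrightarrow>
     (\<forall>p :: nat \<Rightarrow> ('x \<Rightarrow> complex). \<forall>s.
        (\<forall>n. is_projection (CX X) cx_star cx_mult (p n)) \<and>
        (\<forall>m n. m \<noteq> n \<longrightarrow> cx_mult (p m) (p n) = (\<lambda>x. 0)) \<and>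
        is_sup_sa (CX X) cx_star cx_mult {(\<lambda>x. \<Sum>i\<in>F. p i x) | F. finite F} s
      \<longrightarrow> is_sup_sa UNIV cstar (*) {(\<Sum>i\<in>F. \<phi> (p i)) | F. finite F} (\<phi> s))"

end

theory Submission
  imports Defs
begin

text \<open>
  From left to right, the partial sums of an orthogonal sequence of projections form a bounded
  increasing sequence with the same upper bounds as the net of all finite sums.

  From right to left, let \<open>a\<^sub>n\<close> increase to \<open>s\<close> and let \<open>u\<close> dominate every \<open>\<phi>(a\<^sub>n)\<close>. For \<open>e > 0\<close> choose
  clopen sets \<open>W\<^sub>n\<close> between \<open>{s - a\<^sub>n \<le> e/2}\<close> and \<open>{s - a\<^sub>n < e}\<close> and make them disjoint, obtaining \<open>P\<^sub>n\<close>.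
  Their union is dense, since otherwise \<open>s\<close> could be lowered by \<open>e/2\<close> on a nonempty clopen set; hence
  the projections \<open>1\<^sub>P\<^sub>n\<close> sum to \<open>1\<close> in \<open>C(X)\<close>. If \<open>B\<close> bounds all \<open>s - a\<^sub>n\<close>, then
  \<open>s - a\<^sub>n \<le> e + B (1 - \<Sum>\<^sub>i\<^sub>\<in>\<^sub>F 1\<^sub>P\<^sub>i)\<close> for every \<open>F \<subseteq> {0..n}\<close>, so additivity gives
  \<open>0 \<le> u - \<phi>(s) + e \<phi>(1)\<close>, and \<open>e \<rightarrow> 0\<close>.

  This uses that the elements \<open>b\<^sup>* b\<close> of a \<open>C\<^sup>*\<close>-algebra form a closed convex cone, which is obtained
  without spectral theory: by the binomial series for \<open>(1 - x)\<^sup>1\<^sup>/\<^sup>2\<close>, the squares of self-adjoint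
  elements are exactly the self-adjoint \<open>a\<close> with \<open>\<parallel>t - a\<parallel> \<le> t\<close> for some \<open>t\<close>.
\<close>

subsection \<open>The involution\<close>

lemma norm_one_cstar: "norm (1::'a::cstar_algebra) = 1"
proof -
  have "cstar (1::'a) * 1 = 1"
    by (metis cstar_cstar cstar_mult mult_1 mult.right_neutral)
  then have "norm (1::'a) = (norm (1::'a))\<^sup>2"
    using cstar_identity[of "1::'a"] by simp
  then show ?thesis
    by (simp add: power2_eq_square)
qed

text \<open>Gives access to the norm estimates for powers, which bound the terms of the square root
  series.\<close>

instance cstar_algebra \<subseteq> real_normed_algebra_1
  by standard (rule norm_one_cstar)

lemma cstar_zero [simp]: "cstar (0::'a::cstar_algebra) = 0"
  by (metis add_cancel_right_right cstar_add)

lemma cstar_one [simp]: "cstar (1::'a::cstar_algebra) = 1"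
  by (metis cstar_cstar cstar_mult mult_1 mult.right_neutral)

lemma cstar_minus [simp]: "cstar (- a) = - cstar (a::'a::cstar_algebra)"
  by (metis add.right_inverse cstar_add cstar_zero neg_eq_iff_add_eq_0)

lemma cstar_diff [simp]: "cstar (a - b) = cstar a - cstar (b::'a::cstar_algebra)"
  by (metis cstar_add cstar_minus diff_conv_add_uminus)

lemma cstar_scaleR [simp]: "cstar (r *\<^sub>R a) = r *\<^sub>R cstar (a::'a::cstar_algebra)"
  by (simp add: scaleR_scaleC cstar_scaleC)

lemma cstar_power [simp]: "cstar (a ^ n) = cstar (a::'a::cstar_algebra) ^ n"
  by (induction n) (simp_all add: cstar_mult power_commutes)

declare cstar_cstar [simp] cstar_add [simp] cstar_mult [simp]

lemma norm_cstar [simp]: "norm (cstar a) = norm (a::'a::cstar_algebra)"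
proof -
  have le: "norm b \<le> norm (cstar b)" for b :: 'a
  proof (cases "b = 0")
    case False
    have "norm b * norm b \<le> norm (cstar b) * norm b"
      using cstar_identity[of b] norm_mult_ineq[of "cstar b" b] by (simp add: power2_eq_square)
    with False show ?thesis by simp
  qed simp
  show ?thesis
    using le[of a] le[of "cstar a"] by simp
qed

lemma bounded_linear_cstar: "bounded_linear (cstar :: 'a::cstar_algebra \<Rightarrow> 'a)"
  by (rule bounded_linear_intro[where K = 1]) simp_all

lemma norm_square_self_adjoint:
  fixes a :: "'a::cstar_algebra"
  assumes "cstar a = a"
  shows "norm (a * a) = (norm a)\<^sup>2"
  using cstar_identity[of a] assms by simp

lemma scaleC_minus_left [simp]: "scaleC (- c) a = - scaleC c (a::'a::cstar_algebra)"
  using scaleR_scaleC[of "-1" "scaleC c a"] by (simp add: scaleC_scaleC)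

lemma scaleC_diff_right: "scaleC c (a - b) = scaleC c a - scaleC c (b::'a::cstar_algebra)"
  by (metis diff_eq_eq scaleC_add_right)

declare scaleC_one [simp]

text \<open>
  For self-adjoint commuting \<open>p\<close>, \<open>q\<close>, the element \<open>u = p + i q\<close> has \<open>u\<^sup>* u = p\<^sup>2 + q\<^sup>2\<close>,
  and \<open>p = (u + u\<^sup>*) / 2\<close>.
\<close>
lemma norm_le_of_commuting_sum_squares:
  fixes p q :: "'a::cstar_algebra"
  assumes "cstar p = p" "cstar q = q" "p * q = q * p"
  shows "(norm p)\<^sup>2 \<le> norm (p * p + q * q)"
proof -
  define u where "u = p + scaleC \<i> q"
  have su: "cstar u = p - scaleC \<i> q"
    by (simp add: u_def assms cstar_scaleC)
  have "cstar u * u = p * p + q * q"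
    unfolding su unfolding u_def
    by (simp add: algebra_simps scaleC_diff_right scaleC_mult_left scaleC_mult_right scaleC_scaleC assms)
  then have nu: "(norm u)\<^sup>2 = norm (p * p + q * q)"
    using cstar_identity[of u] by simp
  have "2 *\<^sub>R p = u + cstar u"
    unfolding su by (simp add: u_def scaleR_2)
  then have "2 * norm p = norm (u + cstar u)"
    by (metis abs_numeral norm_scaleR)
  also have "\<dots> \<le> 2 * norm u"
    using norm_triangle_ineq[of u "cstar u"] by simp
  finally show ?thesis
    unfolding nu[symmetric] by (intro power_mono) auto
qed

subsection \<open>Square roots\<close>

text \<open>The coefficient of \<open>x^k\<close> in the binomial series of
  \<open>(1 - x)^(1/2)\<close>; the Pochhammer form keeps its sign visible.\<close>

definition sqrt_coeff :: "nat \<Rightarrow> real" where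
  "sqrt_coeff k = pochhammer (- (1/2)) k / fact k"

lemma sqrt_coeff_0 [simp]: "sqrt_coeff 0 = 1"
  by (simp add: sqrt_coeff_def)

text \<open>Splitting off the first factor of the Pochhammer symbol leaves \<open>-1/2\<close> times
  the nonnegative \<open>pochhammer (1/2) k\<close>.\<close>

lemma sqrt_coeff_Suc_nonpos: "sqrt_coeff (Suc k) \<le> 0"
  using pochhammer_nonneg[of "1/2 :: real" k]
  by (simp add: sqrt_coeff_def pochhammer_rec field_simps del: fact_Suc)

text \<open>Partial sums are the coefficients of
  \<open>(1 - x)^(1/2) / (1 - x) = (1 - x)^(-1/2)\<close>; the point is that they are
  nonnegative.\<close>

lemma sum_sqrt_coeff: "(\<Sum>k\<le>n. sqrt_coeff k) = pochhammer (1/2) n / fact n"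
proof (induction n)
  case (Suc n)
  have "(\<Sum>k\<le>Suc n. sqrt_coeff k) = pochhammer (1/2) n / fact n - (1/2) * pochhammer (1/2) n / fact (Suc n)"
    using Suc by (simp add: sqrt_coeff_def[of "Suc n"] pochhammer_rec del: fact_Suc)
  also have "\<dots> = pochhammer (1/2) n * (1/2 + real n) / fact (Suc n)"
    by (simp add: divide_simps) (simp add: algebra_simps)
  finally show ?case
    by (simp add: pochhammer_Suc)
qed simp

text \<open>Beyond the constant coefficient 1 all are nonpositive, so their absolute values add up
  to 1 minus a nonnegative partial sum. Hence the series converges absolutely even for
  \<open>norm x = 1\<close>.\<close>

lemma sum_abs_sqrt_coeff_le: "(\<Sum>k<n. \<bar>sqrt_coeff (Suc k)\<bar>) \<le> 1"
proof -
  have "(\<Sum>k\<le>n. sqrt_coeff k) = 1 + (\<Sum>k<n. sqrt_coeff (Suc k))"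
    by (simp add: sum.atMost_shift)
  moreover have "(\<Sum>k<n. \<bar>sqrt_coeff (Suc k)\<bar>) = - (\<Sum>k<n. sqrt_coeff (Suc k))"
    by (simp add: sum_negf[symmetric] abs_of_nonpos sqrt_coeff_Suc_nonpos)
  moreover have "0 \<le> (\<Sum>k\<le>n. sqrt_coeff k)"
    unfolding sum_sqrt_coeff using pochhammer_nonneg[of "1/2 :: real" n] by simp
  ultimately show ?thesis by simp
qed

lemma summable_abs_sqrt_coeff_Suc: "summable (\<lambda>k. \<bar>sqrt_coeff (Suc k)\<bar>)"
  by (rule summableI_nonneg_bounded[where x = 1]) (simp_all add: sum_abs_sqrt_coeff_le)

lemma suminf_abs_sqrt_coeff_Suc: "(\<Sum>k. \<bar>sqrt_coeff (Suc k)\<bar>) \<le> 1"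
  by (rule suminf_le_const[OF summable_abs_sqrt_coeff_Suc sum_abs_sqrt_coeff_le])

text \<open>Vandermonde with \<open>1/2 + 1/2 = 1\<close>: the square of the series is
  \<open>1 - x\<close>.\<close>

lemma sqrt_coeff_convolution:
  "(\<Sum>i\<le>n. sqrt_coeff i * sqrt_coeff (n - i)) = (if n = 0 then 1 else if n = 1 then - 1 else 0)"
proof -
  have c: "sqrt_coeff k = (-1) ^ k * ((1/2) gchoose k)" for k
    by (simp add: sqrt_coeff_def gbinomial_pochhammer)
  have "(\<Sum>i\<le>n. sqrt_coeff i * sqrt_coeff (n - i))
      = (\<Sum>i\<le>n. (-1) ^ n * (((1/2) gchoose i) * ((1/2) gchoose (n - i))))"
  proof (rule sum.cong)
    fix i assume "i \<in> {..n}"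
    then have "(-1::real) ^ n = (-1) ^ i * (-1) ^ (n - i)"
      by (simp flip: power_add)
    then show "sqrt_coeff i * sqrt_coeff (n - i)
        = (-1) ^ n * (((1/2) gchoose i) * ((1/2) gchoose (n - i)))"
      by (simp add: c)
  qed simp
  also have "\<dots> = (-1) ^ n * (1 gchoose n)"
    using gbinomial_Vandermonde[of "1/2::real" "1/2" n]
    by (simp add: sum_distrib_left[symmetric] atLeast0AtMost)
  also have "(1::real) gchoose n = real (1 choose n)"
    by (metis binomial_gbinomial of_nat_1)
  finally show ?thesis
    by (cases n; cases "n - 1") auto
qed

text \<open>The bound on \<open>1 - b\<close> allows a second application to
  \<open>b = 1 - (1 - b)\<close>, so the root is itself a square. The commutation clause holds
  because \<open>b\<close> is a limit of polynomials in \<open>x\<close>; it serves in place of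
  functional calculus.\<close>

lemma sqrt_one_minus:
  fixes x :: "'a::cstar_algebra"
  assumes sa: "cstar x = x" and x: "norm x \<le> 1"
  obtains b where "cstar b = b" "b * b = 1 - x" "norm (1 - b) \<le> 1"
    "\<And>c. c * x = x * c \<Longrightarrow> c * b = b * c"
proof -
  define f where "f k = sqrt_coeff k *\<^sub>R x ^ k" for k
  have nf: "norm (f k) \<le> \<bar>sqrt_coeff k\<bar>" for k
  proof -
    have "norm (x ^ k) \<le> 1"
      using norm_power_ineq[of x k] x by (meson norm_ge_zero order_trans power_le_one)
    then show ?thesis
      by (simp add: f_def mult_left_le)
  qed
  have sum_norm_Suc: "summable (\<lambda>k. norm (f (Suc k)))"
    by (rule summable_comparison_test'[OF summable_abs_sqrt_coeff_Suc, of 0])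
      (simp add: nf)
  then have sum_norm: "summable (\<lambda>k. norm (f k))"
    using summable_Suc_iff by blast
  then have sum_f: "summable f"
    by (rule summable_norm_cancel)
  define b where "b = suminf f"
  have fb: "f sums b"
    using sum_f by (simp add: b_def summable_sums)
  have "cstar b = suminf (\<lambda>k. cstar (f k))"
    unfolding b_def by (rule bounded_linear.suminf[OF bounded_linear_cstar sum_f])
  also have "(\<lambda>k. cstar (f k)) = f"
    by (simp add: fun_eq_iff f_def sa)
  also have "suminf f = b"
    by (simp add: b_def)
  finally have 1: "cstar b = b" .
  have "(\<lambda>k. \<Sum>i\<le>k. f i * f (k - i)) sums (b * b)"
    unfolding b_def by (rule Cauchy_product_sums[OF sum_norm sum_norm])
  moreover have "(\<Sum>i\<le>k. f i * f (k - i)) = (\<Sum>i\<le>k. sqrt_coeff i * sqrt_coeff (k - i)) *\<^sub>R x ^ k" for k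
    unfolding scaleR_sum_left
    by (rule sum.cong) (simp_all add: f_def flip: power_add)
  ultimately have "(\<lambda>k. (if k = 0 then 1 else if k = 1 then - 1 else 0) *\<^sub>R x ^ k) sums (b * b)"
    by (simp only: sqrt_coeff_convolution)
  moreover have "(\<lambda>k. (if k = 0 then 1 else if k = 1 then - 1 else 0) *\<^sub>R x ^ k) sums
      (\<Sum>k\<in>{0,1}. (if k = 0 then 1 else if k = 1 then - 1 else 0) *\<^sub>R x ^ k)"
    by (rule sums_finite) auto
  ultimately have 2: "b * b = 1 - x"
    by (auto dest: sums_unique2)
  have "b = (\<Sum>k. f (Suc k)) + f 0"
    unfolding b_def using suminf_split_head[OF sum_f] by simp
  then have "norm (1 - b) = norm (\<Sum>k. f (Suc k))"
    by (simp add: f_def)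
  also have "\<dots> \<le> (\<Sum>k. norm (f (Suc k)))"
    by (rule summable_norm[OF sum_norm_Suc])
  also have "\<dots> \<le> (\<Sum>k. \<bar>sqrt_coeff (Suc k)\<bar>)"
    by (rule suminf_le[OF nf sum_norm_Suc summable_abs_sqrt_coeff_Suc])
  also have "\<dots> \<le> 1"
    by (rule suminf_abs_sqrt_coeff_Suc)
  finally have 3: "norm (1 - b) \<le> 1" .
  have 4: "c * b = b * c" if "c * x = x * c" for c
  proof -
    have "c * x ^ k = x ^ k * c" for k
      using that by (rule power_commuting_commutes[symmetric, OF sym])
    then have "c * f k = f k * c" for k
      by (simp add: f_def)
    moreover have "(\<lambda>k. c * f k) sums (c * b)" "(\<lambda>k. f k * c) sums (b * c)"
      using fb by (auto intro: sums_mult sums_mult2)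
    ultimately show ?thesis
      by (auto dest: sums_unique2)
  qed
  show ?thesis
    using that 1 2 3 4 by blast
qed

subsection \<open>The positive cone\<close>

text \<open>Works as the positive cone until \<open>pos_el_iff_sa_square\<close> identifies it with
  the elements \<open>cstar b * b\<close>.\<close>

definition sa_square :: "'a::cstar_algebra \<Rightarrow> bool" where
  "sa_square a \<longleftrightarrow> (\<exists>b. cstar b = b \<and> a = b * b)"

lemma sa_squareI: "cstar b = b \<Longrightarrow> sa_square (b * b)"
  by (auto simp: sa_square_def)

lemma sa_square_self_adjoint: "sa_square a \<Longrightarrow> cstar a = a"
  by (auto simp: sa_square_def)

lemma sa_square_scaleR:
  assumes "sa_square a" "0 \<le> r"
  shows "sa_square (r *\<^sub>R a)"
proof -
  obtain b where b: "cstar b = b" "a = b * b"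
    using assms by (auto simp: sa_square_def)
  have "r *\<^sub>R a = (sqrt r *\<^sub>R b) * (sqrt r *\<^sub>R b)"
    using assms by (simp add: b)
  then show ?thesis
    using sa_squareI[of "sqrt r *\<^sub>R b"] b(1) by (metis cstar_scaleR)
qed

text \<open>By rescaling, \<open>x = 1 - a / t\<close> is a self-adjoint contraction, and
  \<open>sqrt t\<close> times the root of \<open>1 - x\<close> is a root of
  \<open>a\<close>.\<close>

lemma sa_square_of_norm_le:
  fixes a :: "'a::cstar_algebra"
  assumes sa: "cstar a = a" and le: "norm (t *\<^sub>R 1 - a) \<le> t"
  obtains q where "cstar q = q" "q * q = a" "sa_square q" "\<And>c. c * a = a * c \<Longrightarrow> c * q = q * c"
proof (cases "t = 0")
  case True
  then have "a = 0"
    using le by simp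
  then show ?thesis
    using that[of 0] sa_squareI[of 0] by simp
next
  case False
  then have t: "0 < t"
    using le norm_ge_zero[of "t *\<^sub>R 1 - a"] by linarith
  define x where "x = 1 - (1 / t) *\<^sub>R a"
  have x: "t *\<^sub>R x = t *\<^sub>R 1 - a"
    using t by (simp add: x_def scaleR_diff_right)
  then have "t * norm x \<le> t"
    using le t by (metis abs_of_pos norm_scaleR)
  then have "norm x \<le> 1"
    using t by simp
  moreover have "cstar x = x"
    by (simp add: x_def sa)
  ultimately obtain b where b: "cstar b = b" "b * b = 1 - x" "norm (1 - b) \<le> 1"
    "\<And>c. c * x = x * c \<Longrightarrow> c * b = b * c"
    using sqrt_one_minus[of x] by blast
  have "cstar (1 - b) = 1 - b"
    by (simp add: b(1))
  then obtain d where "cstar d = d" "d * d = 1 - (1 - b)"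
    using sqrt_one_minus[of "1 - b"] b(3) by blast
  then have "sa_square b"
    using sa_squareI[of d] by simp
  show ?thesis
  proof (rule that[of "sqrt t *\<^sub>R b"])
    show "cstar (sqrt t *\<^sub>R b) = sqrt t *\<^sub>R b"
      by (simp add: b(1))
    show "(sqrt t *\<^sub>R b) * (sqrt t *\<^sub>R b) = a"
      using t by (simp add: b(2) x_def)
    show "sa_square (sqrt t *\<^sub>R b)"
      using \<open>sa_square b\<close> t by (simp add: sa_square_scaleR)
    show "c * (sqrt t *\<^sub>R b) = (sqrt t *\<^sub>R b) * c" if "c * a = a * c" for c
      using b(4)[of c] that by (simp add: x_def algebra_simps)
  qed
qed

lemma sa_square_if_norm_le:
  fixes a :: "'a::cstar_algebra"
  assumes "cstar a = a" "norm (t *\<^sub>R 1 - a) \<le> t"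
  shows "sa_square a"
proof -
  obtain q where "cstar q = q" "q * q = a"
    using sa_square_of_norm_le[OF assms] by blast
  then show ?thesis
    using sa_squareI[of q] by simp
qed

text \<open>Write \<open>a = t e^2\<close> with \<open>norm (e^2) \<le> 1\<close>. The root
  \<open>q\<close> of \<open>1 - e^2\<close> commutes with \<open>e\<close>, so
  \<open>norm (1 - e^2) = (norm q)^2 \<le> norm (q^2 + e^2) = 1\<close>.\<close>

lemma norm_le_if_sa_square:
  fixes a :: "'a::cstar_algebra"
  assumes "sa_square a" "norm a \<le> t"
  shows "norm (t *\<^sub>R 1 - a) \<le> t"
proof (cases "t = 0")
  case True
  then show ?thesis
    using assms by simp
next
  case False
  then have t: "0 < t"
    using assms norm_ge_zero[of a] by linarith
  obtain b where b: "cstar b = b" "a = b * b"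
    using assms by (auto simp: sa_square_def)
  define e where "e = (1 / sqrt t) *\<^sub>R b"
  have e: "cstar e = e" "t *\<^sub>R (e * e) = a"
    using t by (simp_all add: e_def b real_sqrt_mult_self)
  have "t * norm (e * e) \<le> t"
    using e assms t by (metis abs_of_pos norm_scaleR)
  then have "norm (e * e) \<le> 1"
    using t by simp
  moreover have "cstar (e * e) = e * e"
    by (simp add: e)
  ultimately obtain q where q: "cstar q = q" "q * q = 1 - e * e"
    "\<And>c. c * (e * e) = (e * e) * c \<Longrightarrow> c * q = q * c"
    using sqrt_one_minus[of "e * e"] by blast
  have "e * q = q * e"
    by (rule q(3)) (simp add: mult.assoc)
  then have "(norm q)\<^sup>2 \<le> norm (q * q + e * e)"
    by (intro norm_le_of_commuting_sum_squares) (simp_all add: q(1) e)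
  then have "(norm q)\<^sup>2 \<le> 1"
    by (simp add: q(2))
  then have "norm (1 - e * e) \<le> 1"
    using norm_square_self_adjoint[of q] q(1,2) by simp
  moreover have "t *\<^sub>R 1 - a = t *\<^sub>R (1 - e * e)"
    by (simp add: scaleR_diff_right e)
  ultimately show ?thesis
    using t by simp
qed

lemma sa_square_root:
  fixes a :: "'a::cstar_algebra"
  assumes "sa_square a"
  obtains q where "cstar q = q" "q * q = a" "sa_square q" "\<And>c. c * a = a * c \<Longrightarrow> c * q = q * c"
  using sa_square_of_norm_le[OF sa_square_self_adjoint norm_le_if_sa_square, OF assms assms order_refl]
  by blast

text \<open>The norm criteria for \<open>a\<close> at \<open>norm a\<close> and for \<open>b\<close>
  at \<open>norm b\<close> add up by the triangle inequality.\<close>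

lemma sa_square_add:
  assumes "sa_square a" "sa_square b"
  shows "sa_square (a + b)"
proof (rule sa_square_if_norm_le)
  show "cstar (a + b) = a + b"
    by (simp add: assms sa_square_self_adjoint)
  have "(norm a + norm b) *\<^sub>R 1 - (a + b) = (norm a *\<^sub>R 1 - a) + (norm b *\<^sub>R 1 - b)"
    by (simp add: algebra_simps)
  also have "norm \<dots> \<le> norm a + norm b"
    using norm_le_if_sa_square[OF assms(1) order_refl] norm_le_if_sa_square[OF assms(2) order_refl]
    by (meson add_mono norm_triangle_ineq order_trans)
  finally show "norm ((norm a + norm b) *\<^sub>R 1 - (a + b)) \<le> norm a + norm b" .
qed

lemma sa_square_norm_minus:
  assumes "cstar a = a" "norm a \<le> t"
  shows "sa_square (t *\<^sub>R 1 - a)"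
  by (rule sa_square_if_norm_le[where t = t]) (simp_all add: assms)

text \<open>The sum of \<open>norm y - y\<close> and \<open>y - x\<close> is a square
  \<open>q^2\<close>, where \<open>q\<close> commutes with a root \<open>p\<close> of
  \<open>x\<close>. Then \<open>p^2 + q^2\<close> is the scalar \<open>norm y\<close>, which bounds
  \<open>(norm p)^2 = norm x\<close>.\<close>

lemma sa_square_norm_mono:
  assumes "sa_square x" "sa_square (y - x)"
  shows "norm x \<le> norm y"
proof -
  have "cstar y = y"
    using assms[THEN sa_square_self_adjoint] by simp
  then have "sa_square ((norm y *\<^sub>R 1 - y) + (y - x))"
    by (intro sa_square_add assms sa_square_norm_minus) simp_all
  then have "sa_square (norm y *\<^sub>R 1 - x)"
    by simp
  then obtain q where q: "cstar q = q" "q * q = norm y *\<^sub>R 1 - x"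
    "\<And>c. c * (norm y *\<^sub>R 1 - x) = (norm y *\<^sub>R 1 - x) * c \<Longrightarrow> c * q = q * c"
    using sa_square_root by blast
  obtain p where p: "cstar p = p" "x = p * p"
    using assms by (auto simp: sa_square_def)
  have "p * q = q * p"
    by (rule q(3)) (simp add: p algebra_simps)
  then have "(norm p)\<^sup>2 \<le> norm (p * p + q * q)"
    by (intro norm_le_of_commuting_sum_squares) (simp_all add: p q(1))
  then show ?thesis
    using norm_square_self_adjoint[of p] p q(1,2) by simp
qed

text \<open>Replaces the usual comparison of the spectra of \<open>cstar c * c\<close> and
  \<open>c * cstar c\<close>: after normalising \<open>c\<close> to \<open>e\<close>, both
  \<open>h\<close> and \<open>k\<close> turn out positive of norm 1, which a norm estimate
  refutes.\<close>

lemma eq_0_if_sa_square_minus_cstar_mult: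
  fixes c :: "'a::cstar_algebra"
  assumes "sa_square (- (cstar c * c))"
  shows "c = 0"
proof (rule ccontr)
  assume "c \<noteq> 0"
  define e where "e = (1 / norm c) *\<^sub>R c"
  have ne: "norm e = 1"
    using \<open>c \<noteq> 0\<close> by (simp add: e_def)
  define h where "h = - (cstar e * e)"
  define k where "k = e * cstar e"
  have "h = (1 / norm c)\<^sup>2 *\<^sub>R (- (cstar c * c))"
    by (simp add: h_def e_def power2_eq_square)
  then have h: "sa_square h"
    using assms by (simp only: sa_square_scaleR zero_le_power2)
  \<comment> \<open>Up to sign, \<open>x\<close> and \<open>y\<close> are twice the real and
    imaginary parts of \<open>e\<close>; half of \<open>x^2 + y^2\<close> is
    \<open>e * cstar e + cstar e * e\<close>, which makes \<open>k\<close> a sum of positive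
    elements.\<close>
  define x where "x = e + cstar e"
  define y where "y = scaleC \<i> (e - cstar e)"
  have x: "cstar x = x"
    by (simp add: x_def add.commute)
  have y: "cstar y = y"
    by (simp add: y_def cstar_scaleC scaleC_diff_right)
  have "x * x + y * y = 2 *\<^sub>R (k - h)"
    by (simp add: x_def y_def k_def h_def scaleC_mult_left scaleC_mult_right scaleC_scaleC scaleC_diff_right
        algebra_simps scaleR_2)
  then have "k = (1/2) *\<^sub>R (x * x + y * y) + h"
    by simp
  moreover have "sa_square ((1/2) *\<^sub>R (x * x + y * y) + h)"
    by (intro sa_square_add sa_square_scaleR sa_squareI x y h) simp
  ultimately have k: "sa_square k"
    by simp
  then obtain p where p: "cstar p = p" "k = p * p"
    by (auto simp: sa_square_def)
  have nk: "norm k = 1"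
    using cstar_identity[of "cstar e"] ne by (simp add: k_def)
  have nh: "norm h = 1"
    using cstar_identity[of e] ne by (simp add: h_def)
  \<comment> \<open>\<open>e\<^sup>*(1 + k) = (1 - h) e\<^sup>*\<close> is a contraction, but its square is \<open>k + 2k\<^sup>2 + k\<^sup>3 \<ge> 2k\<^sup>2\<close>.\<close>
  define z where "z = cstar e * (1 + k)"
  have "z = (1 - h) * cstar e"
    by (simp add: z_def k_def h_def algebra_simps)
  then have "norm z \<le> norm (1 - h) * norm (cstar e)"
    using norm_mult_ineq[of "1 - h" "cstar e"] by simp
  also have "norm (1 - h) \<le> 1"
    using norm_le_if_sa_square[OF h, of 1] nh by simp
  finally have nz: "norm z \<le> 1"
    by (simp add: ne)
  have "cstar z * z = (1 + k) * k * (1 + k)"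
    using sa_square_self_adjoint[OF k] by (simp add: z_def k_def mult.assoc)
  also have "\<dots> = k + 2 *\<^sub>R (k * k) + k * k * k"
    by (simp add: algebra_simps scaleR_2)
  finally have "cstar z * z = k + 2 *\<^sub>R (k * k) + k * k * k" .
  then have "norm (k + 2 *\<^sub>R (k * k) + k * k * k) \<le> 1"
    using cstar_identity[of z] nz by (metis norm_ge_zero power_le_one)
  moreover have "norm (2 *\<^sub>R (k * k)) \<le> norm (k + 2 *\<^sub>R (k * k) + k * k * k)"
  proof (rule sa_square_norm_mono)
    show "sa_square (2 *\<^sub>R (k * k))"
      using sa_square_self_adjoint[OF k] by (intro sa_square_scaleR sa_squareI) simp_all
    have "sa_square ((p * k) * (p * k))"
      by (rule sa_squareI) (simp add: p mult.assoc)
    then have "sa_square (k * k * k)"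
      by (simp add: p mult.assoc)
    then have "sa_square (k + k * k * k)"
      by (rule sa_square_add[OF k])
    then show "sa_square (k + 2 *\<^sub>R (k * k) + k * k * k - 2 *\<^sub>R (k * k))"
      by (simp add: algebra_simps)
  qed
  moreover have "norm (k * k) = 1"
    using norm_square_self_adjoint[of k] sa_square_self_adjoint[OF k] nk by simp
  ultimately show False
    by simp
qed

text \<open>
  With \<open>r = (a\<^sup>2)\<^sup>1\<^sup>/\<^sup>2\<close>, the element \<open>d = r - a\<close> is twice the negative part of \<open>a = b\<^sup>* b\<close>, and
  \<open>(b d)\<^sup>* (b d) = d a d = - r d\<^sup>2\<close> is negative.
\<close>
lemma sa_square_cstar_mult:
  fixes b :: "'a::cstar_algebra"
  shows "sa_square (cstar b * b)"
proof -
  define a where "a = cstar b * b"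
  have a: "cstar a = a"
    by (simp add: a_def)
  obtain r where r: "cstar r = r" "r * r = a * a" "sa_square r"
    "\<And>c. c * (a * a) = (a * a) * c \<Longrightarrow> c * r = r * c"
    using sa_square_root[OF sa_squareI[OF a]] by blast
  obtain q where q: "cstar q = q" "q * q = r" "\<And>c. c * r = r * c \<Longrightarrow> c * q = q * c"
    using sa_square_root[OF r(3)] by blast
  have ar: "a * r = r * a"
    by (rule r(4)) (simp add: mult.assoc)
  have ar': "a * (r * x) = r * (a * x)" for x
    by (metis ar mult.assoc)
  have rr': "r * (r * x) = a * (a * x)" for x
    by (metis r(2) mult.assoc)
  define d where "d = r - a"
  have d: "cstar d = d"
    by (simp add: d_def r a)
  have dq: "d * q = q * d"
    by (rule q(3)) (simp add: d_def algebra_simps ar)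
  have dad: "- (d * a * d) = r * d * d"
    by (simp add: d_def algebra_simps ar ar' rr' r(2))
  have qd: "r * d * d = (q * d) * (q * d)"
    by (metis dq mult.assoc q(2))
  have "- (cstar (b * d) * (b * d)) = (q * d) * (q * d)"
    using dad qd by (simp add: d a_def mult.assoc)
  moreover have "cstar (q * d) = q * d"
    by (simp add: d q dq)
  ultimately have "b * d = 0"
    using eq_0_if_sa_square_minus_cstar_mult[of "b * d"] sa_squareI[of "q * d"] by simp
  then have "d * a * d = 0"
    by (simp add: a_def mult.assoc)
  then have rdd: "r * d * d = 0"
    using dad by simp
  \<comment> \<open>From \<open>r^2 = a^2\<close> and commutation, \<open>d^2 = 2 r d\<close>. So
    \<open>d\<close> is nilpotent and, being self-adjoint, zero by the norm identity for
    squares.\<close>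
  have "d * d * d = 2 *\<^sub>R (r * d * d)"
    by (simp add: d_def algebra_simps ar ar' rr' r(2) scaleR_2)
  then have "(d * d) * (d * d) = 0"
    using rdd by (metis mult.assoc mult_zero_left scaleR_zero_right)
  then have "norm (d * d) = 0"
    using norm_square_self_adjoint[of "d * d"] d by simp
  then have "d = 0"
    using norm_square_self_adjoint[of d] d by simp
  then show ?thesis
    using r(3) by (simp add: d_def a_def)
qed

lemma pos_el_iff_sa_square: "pos_el UNIV cstar (*) a \<longleftrightarrow> sa_square (a::'a::cstar_algebra)"
proof
  assume "sa_square a"
  then obtain b where "cstar b = b" "a = b * b"
    by (auto simp: sa_square_def)
  then have "a = cstar b * b"
    by simp
  then show "pos_el UNIV cstar (*) a"
    by (auto simp: pos_el_def)
qed (auto simp: pos_el_def sa_square_cstar_mult)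

text \<open>One \<open>t\<close> serves the norm criterion for all \<open>e < 1\<close>, and for
  fixed \<open>t\<close> that criterion is a closed condition.\<close>

lemma sa_square_archimedean:
  fixes v w :: "'a::cstar_algebra"
  assumes "cstar v = v" and pos: "\<And>e. 0 < e \<Longrightarrow> sa_square (v + e *\<^sub>R w)"
  shows "sa_square v"
proof (rule sa_square_if_norm_le)
  define t where "t = norm v + norm w"
  have "norm (t *\<^sub>R 1 - (v + e *\<^sub>R w)) \<le> t" if "0 < e" "e < 1" for e
  proof (rule norm_le_if_sa_square[OF pos])
    have "norm (e *\<^sub>R w) \<le> norm w"
      using that by (simp add: mult_left_le_one_le)
    then show "norm (v + e *\<^sub>R w) \<le> t"
      unfolding t_def using norm_triangle_ineq[of v "e *\<^sub>R w"] by linarith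
  qed (use that in simp)
  then have "\<forall>\<^sub>F e in at_right 0. norm (t *\<^sub>R 1 - (v + e *\<^sub>R w)) \<le> t"
    by (auto intro: eventually_at_rightI[of 0 1])
  moreover have "((\<lambda>e. norm (t *\<^sub>R 1 - (v + e *\<^sub>R w))) \<longlongrightarrow> norm (t *\<^sub>R 1 - (v + 0 *\<^sub>R w))) (at_right 0)"
    by (intro tendsto_intros)
  ultimately have "norm (t *\<^sub>R 1 - (v + 0 *\<^sub>R w)) \<le> t"
    by (intro tendsto_upperbound) auto
  then show "norm (t *\<^sub>R 1 - v) \<le> t"
    by simp
qed (rule assms)

subsection \<open>The algebra of continuous functions\<close>

text \<open>The condition \<open>g 0 = 0\<close> keeps the composite zero outside
  \<open>topspace X\<close>, as \<open>CX X\<close> demands.\<close>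

lemma CX_compose:
  assumes "f \<in> CX X" "continuous_on UNIV g" "g 0 = 0"
  shows "(\<lambda>x. g (f x)) \<in> CX X"
proof -
  have "continuous_map X euclidean (g \<circ> f)"
    using assms by (intro continuous_map_compose) (auto simp: CX_def)
  then show ?thesis
    using assms by (auto simp: CX_def comp_def)
qed

lemma CX_add: "f \<in> CX X \<Longrightarrow> g \<in> CX X \<Longrightarrow> (\<lambda>x. f x + g x) \<in> CX X"
  by (auto simp: CX_def intro: continuous_map_add)

lemma CX_diff: "f \<in> CX X \<Longrightarrow> g \<in> CX X \<Longrightarrow> (\<lambda>x. f x - g x) \<in> CX X"
  by (auto simp: CX_def intro: continuous_map_diff)

lemma CX_cmult: "f \<in> CX X \<Longrightarrow> (\<lambda>x. c * f x) \<in> CX X"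
  by (rule CX_compose) (auto intro: continuous_intros)

lemma CX_sum: "finite F \<Longrightarrow> (\<And>i. i \<in> F \<Longrightarrow> p i \<in> CX X) \<Longrightarrow> (\<lambda>x. \<Sum>i\<in>F. p i x) \<in> CX X"
  by (induction F rule: finite_induct) (auto simp: CX_def intro: continuous_map_add)

lemma CX_indicator:
  assumes "openin X W" "closedin X W"
  shows "(indicator W :: 'x \<Rightarrow> complex) \<in> CX X"
proof -
  have W: "W \<subseteq> topspace X" "openin X (topspace X - W)"
    using assms by (auto simp: closedin_def)
  have "openin X {x \<in> topspace X. (indicator W x :: complex) \<in> U}" for U
  proof -
    have "{x \<in> topspace X. (indicator W x :: complex) \<in> U}
        = (if 1 \<in> U then W else {}) \<union> (if 0 \<in> U then topspace X - W else {})"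
      using W(1) by (auto simp: indicator_def)
    then show ?thesis
      using assms(1) W(2) by (simp add: openin_Un)
  qed
  then show ?thesis
    using W(1) by (auto simp: CX_def continuous_map_def indicator_def)
qed

lemma continuous_map_Re_CX:
  assumes "f \<in> CX X"
  shows "continuous_map X euclideanreal (\<lambda>x. Re (f x))"
proof -
  have "continuous_map X euclideanreal (Re \<circ> f)"
    using assms by (intro continuous_map_compose) (auto simp: CX_def intro!: continuous_intros)
  then show ?thesis
    by (simp add: comp_def)
qed

lemma sa_el_CX: "sa_el (CX X) cx_star f \<longleftrightarrow> f \<in> CX X \<and> (\<forall>x. Im (f x) = 0)"
  by (auto simp: sa_el_def cx_star_def fun_eq_iff complex_eq_iff)

lemma pos_el_CX:
  "pos_el (CX X) cx_star cx_mult f \<longleftrightarrow> f \<in> CX X \<and> (\<forall>x. Im (f x) = 0 \<and> 0 \<le> Re (f x))"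
proof
  assume f: "f \<in> CX X \<and> (\<forall>x. Im (f x) = 0 \<and> 0 \<le> Re (f x))"
  define b where "b x = complex_of_real (sqrt (Re (f x)))" for x
  have "b \<in> CX X"
    unfolding b_def using f
    by (intro CX_compose[of f X "\<lambda>z. complex_of_real (sqrt (Re z))"] continuous_intros) simp_all
  moreover have "f = cx_mult (cx_star b) b"
    using f by (auto simp: fun_eq_iff complex_eq_iff cx_mult_def cx_star_def b_def)
  ultimately show "pos_el (CX X) cx_star cx_mult f"
    using f by (auto simp: pos_el_def)
qed (auto simp: pos_el_def cx_mult_def cx_star_def)

lemma sa_le_CX:
  "sa_le (CX X) cx_star cx_mult f g \<longleftrightarrow>
    sa_el (CX X) cx_star f \<and> sa_el (CX X) cx_star g \<and> (\<forall>x. Re (f x) \<le> Re (g x))"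
  unfolding sa_le_def pos_el_CX fun_diff_def
  by (auto simp: sa_el_CX CX_diff)

lemma CX_projection_values:
  assumes "is_projection (CX X) cx_star cx_mult p"
  shows "p x = 0 \<or> p x = 1"
proof -
  have "p x * p x = p x"
    using assms by (auto simp: is_projection_def cx_mult_def fun_eq_iff)
  then show ?thesis
    by simp
qed

lemma sa_el_CX_projection: "is_projection (CX X) cx_star cx_mult p \<Longrightarrow> sa_el (CX X) cx_star p"
  by (simp add: is_projection_def sa_el_def)

lemma is_projection_indicator:
  "openin X W \<Longrightarrow> closedin X W \<Longrightarrow> is_projection (CX X) cx_star cx_mult (indicator W)"
  by (auto simp: is_projection_def CX_indicator cx_star_def cx_mult_def indicator_def fun_eq_iff)

subsection \<open>Positive maps\<close>

lemma sa_le_UNIV: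
  "sa_le UNIV cstar (*) a b \<longleftrightarrow> cstar a = a \<and> cstar b = b \<and> sa_square (b - (a::'a::cstar_algebra))"
  by (simp add: sa_le_def sa_el_def pos_el_iff_sa_square)

context
  fixes X :: "'x topology" and \<phi> :: "('x \<Rightarrow> complex) \<Rightarrow> 'a::cstar_algebra"
  assumes positive: "positive_map X \<phi>"
begin

lemma positive_map_add: "f \<in> CX X \<Longrightarrow> g \<in> CX X \<Longrightarrow> \<phi> (\<lambda>x. f x + g x) = \<phi> f + \<phi> g"
  using positive by (auto simp: positive_map_def)

lemma positive_map_scaleR: "f \<in> CX X \<Longrightarrow> \<phi> (\<lambda>x. complex_of_real r * f x) = r *\<^sub>R \<phi> f"
  using positive by (auto simp: positive_map_def scaleR_scaleC)

lemma positive_map_diff: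
  assumes "f \<in> CX X" "g \<in> CX X"
  shows "\<phi> (\<lambda>x. f x - g x) = \<phi> f - \<phi> g"
  using positive_map_add[OF CX_diff[OF assms] assms(2)] by simp

lemma positive_map_sum:
  assumes "finite F" "\<And>i. i \<in> F \<Longrightarrow> p i \<in> CX X"
  shows "\<phi> (\<lambda>x. \<Sum>i\<in>F. p i x) = (\<Sum>i\<in>F. \<phi> (p i))"
  using assms
proof (induction F rule: finite_induct)
  case empty
  show ?case
    using positive_map_diff[of "\<lambda>x. 0" "\<lambda>x. 0"] by (simp add: CX_def)
next
  case (insert i F)
  then show ?case
    by (simp add: positive_map_add CX_sum)
qed

lemma positive_map_pos: "f \<in> CX X \<Longrightarrow> (\<And>x. Im (f x) = 0 \<and> 0 \<le> Re (f x)) \<Longrightarrow> sa_square (\<phi> f)"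
  using positive by (simp add: positive_map_def pos_el_CX pos_el_iff_sa_square)

text \<open>Positivity controls only positive functions, so \<open>f\<close> is split into its
  positive and negative parts.\<close>

lemma positive_map_self_adjoint:
  assumes "sa_el (CX X) cx_star f"
  shows "cstar (\<phi> f) = \<phi> f"
proof -
  define g where "g x = complex_of_real (max 0 (Re (f x)))" for x
  define h where "h x = complex_of_real (max 0 (- Re (f x)))" for x
  have f: "f \<in> CX X" "\<And>x. Im (f x) = 0"
    using assms by (auto simp: sa_el_CX)
  have g: "g \<in> CX X"
    unfolding g_def
    by (intro CX_compose[OF f(1), of "\<lambda>z. complex_of_real (max 0 (Re z))"] continuous_intros) simp
  have h: "h \<in> CX X"
    unfolding h_def
    by (intro CX_compose[OF f(1), of "\<lambda>z. complex_of_real (max 0 (- Re z))"] continuous_intros) simp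
  have "f = (\<lambda>x. g x - h x)"
    by (auto simp: fun_eq_iff complex_eq_iff f g_def h_def max_def)
  then have "\<phi> f = \<phi> g - \<phi> h"
    using positive_map_diff[OF g h] by simp
  moreover have "sa_square (\<phi> g)" "sa_square (\<phi> h)"
    by (rule positive_map_pos[OF g], simp add: g_def) (rule positive_map_pos[OF h], simp add: h_def)
  ultimately show ?thesis
    by (simp add: sa_square_self_adjoint)
qed

lemma positive_map_mono:
  assumes "sa_le (CX X) cx_star cx_mult f g"
  shows "sa_le UNIV cstar (*) (\<phi> f) (\<phi> g)"
proof -
  have fg: "f \<in> CX X" "g \<in> CX X" "\<And>x. Im (g x - f x) = 0 \<and> 0 \<le> Re (g x - f x)"
    using assms by (auto simp: sa_le_CX sa_el_CX)
  then have "sa_square (\<phi> g - \<phi> f)"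
    using positive_map_pos[OF CX_diff[OF fg(2,1)]] positive_map_diff[OF fg(2,1)] by simp
  then show ?thesis
    using assms by (simp add: sa_le_UNIV sa_le_CX positive_map_self_adjoint)
qed

section \<open>Normality implies additivity on projections\<close>

lemma sigma_additive_proj_if_sigma_normal:
  assumes "sigma_normal X \<phi>"
  shows "sigma_additive_proj X \<phi>"
  unfolding sigma_additive_proj_def
proof (intro allI impI, elim conjE)
  fix p :: "nat \<Rightarrow> 'x \<Rightarrow> complex" and s
  assume proj: "\<forall>n. is_projection (CX X) cx_star cx_mult (p n)"
    and orth: "\<forall>m n. m \<noteq> n \<longrightarrow> cx_mult (p m) (p n) = (\<lambda>x. 0)"
    and sup: "is_sup_sa (CX X) cx_star cx_mult {(\<lambda>x. \<Sum>i\<in>F. p i x) | F. finite F} s"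
  have p_CX: "p i \<in> CX X" for i
    using proj by (auto simp: is_projection_def)
  have p_01: "p i x = 0 \<or> p i x = 1" for i x
    by (rule CX_projection_values[OF proj[rule_format]])
  have p_real: "Im (p i x) = 0 \<and> 0 \<le> Re (p i x)" for i x
    using p_01[of i x] by auto
  have sum_sa: "sa_el (CX X) cx_star (\<lambda>x. \<Sum>i\<in>F. p i x)" if "finite F" for F
    using that by (auto simp: sa_el_CX CX_sum p_CX p_real)
  have sum_mono: "Re (\<Sum>i\<in>F. p i x) \<le> Re (\<Sum>i\<in>G. p i x)" if "finite G" "F \<subseteq> G" for F G x
    using that p_real by (simp add: sum_mono2)
  \<comment> \<open>Orthogonality makes these partial sums 0-1 valued, which supplies the norm bound
    1.\<close>
  define a where "a n = (\<lambda>x. \<Sum>i<n. p i x)" for n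
  have a_01: "a n x = 0 \<or> a n x = 1" for n x
  proof (induction n)
    case (Suc n)
    have "p i x * p n x = 0" if "i < n" for i
      using orth that unfolding cx_mult_def by (metis less_irrefl)
    then have "(\<Sum>i<n. p i x * p n x) = 0"
      by (intro sum.neutral) auto
    then have "a n x * p n x = 0"
      by (simp add: a_def sum_distrib_right)
    then show ?case
      using Suc p_01[of n x] by (auto simp: a_def)
  qed (simp add: a_def)
  have upper: "sa_le (CX X) cx_star cx_mult (\<lambda>x. \<Sum>i\<in>F. p i x) s" if "finite F" for F
    using sup that by (auto simp: is_sup_sa_def)
  have s: "sa_el (CX X) cx_star s"
    using sup by (simp add: is_sup_sa_def)
  have "is_sup_sa (CX X) cx_star cx_mult (range a) s"
    unfolding is_sup_sa_def
  proof (intro conjI ballI allI impI)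
    show "sa_le (CX X) cx_star cx_mult t s" if "t \<in> range a" for t
      using that upper by (auto simp: a_def)
    fix u assume u: "sa_el (CX X) cx_star u \<and> (\<forall>t\<in>range a. sa_le (CX X) cx_star cx_mult t u)"
    \<comment> \<open>Initial segments are cofinal among the finite index sets, so both families
      have the same upper bounds.\<close>
    have "sa_le (CX X) cx_star cx_mult (\<lambda>x. \<Sum>i\<in>F. p i x) u" if F: "finite F" for F
    proof -
      obtain n where n: "F \<subseteq> {..<n}"
        using F finite_nat_bounded by blast
      have "sa_le (CX X) cx_star cx_mult (a n) u"
        using u by auto
      then have "Re (\<Sum>i\<in>F. p i x) \<le> Re (u x)" for x
        using sum_mono[OF _ n, of x] by (auto simp: sa_le_CX a_def intro: order_trans)
      then show ?thesis
        using u sum_sa[OF F] by (simp add: sa_le_CX)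
    qed
    then show "sa_le (CX X) cx_star cx_mult s u"
      using sup u by (auto simp: is_sup_sa_def)
  qed (rule s)
  moreover have "\<forall>n. sa_el (CX X) cx_star (a n)"
    by (simp add: a_def sum_sa)
  moreover have "\<forall>n. sa_le (CX X) cx_star cx_mult (a n) (a (Suc n))"
    unfolding sa_le_CX a_def by (intro allI conjI sum_sa sum_mono) auto
  moreover have "\<exists>B. \<forall>n. \<forall>x\<in>topspace X. cmod (a n x) \<le> B"
    by (intro exI[of _ 1] allI ballI) (metis a_01 norm_one norm_zero zero_le_one order_refl)
  ultimately have sup': "is_sup_sa UNIV cstar (*) (range (\<lambda>n. \<phi> (a n))) (\<phi> s)"
    using assms unfolding sigma_normal_def by blast
  have phi_sum: "(\<Sum>i\<in>F. \<phi> (p i)) = \<phi> (\<lambda>x. \<Sum>i\<in>F. p i x)" if "finite F" for F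
    using positive_map_sum[OF that] p_CX by simp
  show "is_sup_sa UNIV cstar (*) {(\<Sum>i\<in>F. \<phi> (p i)) | F. finite F} (\<phi> s)"
    unfolding is_sup_sa_def
  proof (intro conjI ballI allI impI)
    show "sa_el UNIV cstar (\<phi> s)"
      using sup' by (simp add: is_sup_sa_def)
    show "sa_le UNIV cstar (*) t (\<phi> s)" if "t \<in> {(\<Sum>i\<in>F. \<phi> (p i)) | F. finite F}" for t
      using that positive_map_mono[OF upper] by (auto simp: phi_sum)
    fix u assume u: "sa_el UNIV cstar u \<and> (\<forall>t\<in>{(\<Sum>i\<in>F. \<phi> (p i)) | F. finite F}. sa_le UNIV cstar (*) t u)"
    have "sa_le UNIV cstar (*) (\<phi> (a n)) u" for n
      using u phi_sum[of "{..<n}"] unfolding a_def by (metis (mono_tags, lifting) finite_lessThan mem_Collect_eq)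
    then show "sa_le UNIV cstar (*) (\<phi> s) u"
      using sup' u by (auto simp: is_sup_sa_def)
  qed
qed

end

subsection \<open>Stone spaces\<close>

text \<open>Components are points, and in a compact Hausdorff space a component is separated by a
  clopen set from any closed set disjoint from it. Compactness of \<open>K\<close> passes from
  points to \<open>K\<close>.\<close>

lemma stone_space_clopen_between:
  assumes X: "stone_space X" and K: "closedin X K" and U: "openin X U" and "K \<subseteq> U"
  obtains W where "openin X W" "closedin X W" "K \<subseteq> W" "W \<subseteq> U"
proof -
  have comp: "compact_space X" and haus: "Hausdorff_space X"
    using X by (auto simp: stone_space_def)
  have "separated_between X {x} (topspace X - U)" if "x \<in> K" for x
  proof (rule separated_between_compact_connected_component)
    have x: "x \<in> topspace X"
      using that K closedin_subset by blast
    obtain a where "connected_component_of_set X x \<subseteq> {a}"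
      using X connectedin_connected_component_of unfolding stone_space_def by meson
    moreover have "x \<in> connected_component_of_set X x"
      using x by (simp add: connected_component_of_refl)
    ultimately have "connected_component_of_set X x = {x}"
      by blast
    then show "{x} \<in> connected_components_of X"
      using x by (metis connected_component_in_connected_components_of)
    show "compactin X {x}"
      using x by simp
    show "disjnt {x} (topspace X - U)"
      using that \<open>K \<subseteq> U\<close> by auto
  qed (use comp haus U in \<open>auto simp: compact_imp_locally_compact_space\<close>)
  then have "separated_between X K (topspace X - U)"
    using separated_between_pointwise_left[OF closedin_compact_space[OF comp K]] by auto
  then obtain W where W: "closedin X W" "openin X W" "K \<subseteq> W" "topspace X - U \<subseteq> topspace X - W"
    by (auto simp: separated_between)
  then have "W \<subseteq> U"
    using openin_subset[of X W] by blast
  with W show ?thesis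
    using that by blast
qed

lemma stone_space_clopen_neighbourhood:
  assumes "stone_space X" "openin X U" "x \<in> U"
  obtains W where "openin X W" "closedin X W" "x \<in> W" "W \<subseteq> U"
proof -
  have "closedin X {x}"
    using assms openin_subset[of X U]
    by (intro closedin_Hausdorff_singleton) (auto simp: stone_space_def)
  then show ?thesis
    using stone_space_clopen_between[OF assms(1) _ assms(2), of "{x}"] assms(3) that by auto
qed

text \<open>
  If \<open>a\<^sub>n\<close> increases to \<open>s\<close> in \<open>C(X)\<close>, then, even though the convergence need not be pointwise,
  the sets \<open>{s - a\<^sub>n < e}\<close> have dense union.
\<close>
lemma is_sup_partition_of_unity:
  assumes X: "stone_space X"
    and sup: "is_sup_sa (CX X) cx_star cx_mult (range a) s"
    and P: "\<And>n. openin X (P n)" "\<And>n. closedin X (P n)" "disjoint_family P"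
    and cover: "\<And>n x. x \<in> topspace X \<Longrightarrow> Re (s x) - Re (a n x) \<le> e \<Longrightarrow> x \<in> (\<Union>n. P n)"
    and e: "0 < e"
  shows "is_sup_sa (CX X) cx_star cx_mult
    {(\<lambda>x. \<Sum>i\<in>F. indicator (P i) x) | F :: nat set. finite F} (indicator (topspace X))"
  unfolding is_sup_sa_def
proof (intro conjI ballI allI impI)
  have ind: "sa_el (CX X) cx_star (indicator W)" if "openin X W" "closedin X W" for W
    using that by (intro sa_el_CX_projection is_projection_indicator)
  show top: "sa_el (CX X) cx_star (indicator (topspace X))"
    by (rule ind) auto
  show "sa_le (CX X) cx_star cx_mult t (indicator (topspace X))"
    if t: "t \<in> {(\<lambda>x. \<Sum>i\<in>F. indicator (P i) x) | F. finite F}" for t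
  proof -
    obtain F where F: "finite F" "t = (\<lambda>x. \<Sum>i\<in>F. indicator (P i) x)"
      using t by blast
    have "t = indicator (\<Union>i\<in>F. P i)"
      unfolding F(2) fun_eq_iff
      using indicator_UN_disjoint[OF F(1)] P(3) by (metis disjoint_family_on_mono subset_UNIV)
    moreover have "openin X (\<Union>i\<in>F. P i)" "closedin X (\<Union>i\<in>F. P i)"
      using P(1,2) F(1) by (auto intro!: closedin_Union openin_Union)
    ultimately show ?thesis
      using openin_subset[of X "\<Union>i\<in>F. P i"] by (auto simp: sa_le_CX ind top indicator_def)
  qed
  fix u
  assume "sa_el (CX X) cx_star u \<and>
    (\<forall>t\<in>{(\<lambda>x. \<Sum>i\<in>F. indicator (P i) x) | F :: nat set. finite F}. sa_le (CX X) cx_star cx_mult t u)"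
  then have u: "sa_el (CX X) cx_star u"
    and ub: "finite F \<Longrightarrow> sa_le (CX X) cx_star cx_mult (\<lambda>x. \<Sum>i\<in>F. indicator (P i) x) u" for F :: "nat set"
    by blast+
  have uP: "1 \<le> Re (u x)" if "x \<in> P n" for n x
  proof -
    have "Re (indicator (P n) x) \<le> Re (u x)"
      using ub[of "{n}"] by (simp add: sa_le_CX)
    then show ?thesis
      using that by simp
  qed
  have "1 \<le> Re (u x)" if x: "x \<in> topspace X" for x
  proof (rule ccontr)
    assume "\<not> 1 \<le> Re (u x)"
    define D where "D = {x \<in> topspace X. Re (u x) \<in> {..<1}}"
    have "continuous_map X euclidean (\<lambda>x. Re (u x))"
      using u by (intro continuous_map_Re_CX) (simp add: sa_el_CX)
    then have "openin X D"
      unfolding D_def by (rule openin_continuous_map_preimage) simp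
    moreover have "x \<in> D"
      using x \<open>\<not> 1 \<le> Re (u x)\<close> by (simp add: D_def)
    ultimately obtain C where C: "openin X C" "closedin X C" "x \<in> C" "C \<subseteq> D"
      using stone_space_clopen_neighbourhood[OF X] by blast
    \<comment> \<open>On \<open>C\<close> the bound \<open>u\<close> is below 1, so \<open>C\<close>
      misses every \<open>P n\<close> and all gaps exceed \<open>e\<close> there. Lowering
      \<open>s\<close> by \<open>e\<close> on \<open>C\<close> thus leaves an upper bound of all
      \<open>a n\<close>, contradicting minimality of \<open>s\<close>.\<close>
    define v where "v = (\<lambda>y. s y - complex_of_real e * indicator C y)"
    have s: "sa_el (CX X) cx_star s"
      using sup by (simp add: is_sup_sa_def)
    then have v: "sa_el (CX X) cx_star v"
      using ind[OF C(1,2)] by (auto simp: v_def sa_el_CX CX_diff CX_cmult)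
    have "sa_le (CX X) cx_star cx_mult (a n) v" for n
    proof -
      have an: "sa_le (CX X) cx_star cx_mult (a n) s"
        using sup by (auto simp: is_sup_sa_def)
      have "Re (a n y) \<le> Re (v y)" for y
      proof (cases "y \<in> C")
        case True
        then have "y \<in> topspace X" "Re (u y) < 1"
          using C(4) by (auto simp: D_def)
        then have "y \<notin> (\<Union>n. P n)"
          using uP[of y] by force
        then have "e < Re (s y) - Re (a n y)"
          using cover[of y n] \<open>y \<in> topspace X\<close> by force
        then show ?thesis
          using True by (simp add: v_def)
      next
        case False
        then show ?thesis
          using an by (simp add: v_def sa_le_CX)
      qed
      then show ?thesis
        using an v by (simp add: sa_le_CX)
    qed
    then have "sa_le (CX X) cx_star cx_mult s v"
      using sup v by (auto simp: is_sup_sa_def)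
    then have "Re (s x) \<le> Re (v x)"
      by (simp add: sa_le_CX)
    then show False
      using C(3) e by (simp add: v_def)
  qed
  moreover have "Re (u x) = 0" if "x \<notin> topspace X" for x
    using u that by (simp add: sa_el_def CX_def)
  ultimately show "sa_le (CX X) cx_star cx_mult (indicator (topspace X)) u"
    using u top by (auto simp: sa_le_CX indicator_def)
qed

section \<open>Additivity on projections implies normality\<close>

lemma sigma_normal_if_sigma_additive_proj:
  fixes X :: "'x topology" and \<phi> :: "('x \<Rightarrow> complex) \<Rightarrow> 'a::cstar_algebra"
  assumes X: "stone_space X" and pos: "positive_map X \<phi>" and add: "sigma_additive_proj X \<phi>"
  shows "sigma_normal X \<phi>"
  unfolding sigma_normal_def
proof (intro allI impI, elim conjE exE)
  fix a :: "nat \<Rightarrow> 'x \<Rightarrow> complex" and s B0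
  assume sa: "\<forall>n. sa_el (CX X) cx_star (a n)"
    and bdd: "\<forall>n. \<forall>x\<in>topspace X. cmod (a n x) \<le> B0"
    and inc: "\<forall>n. sa_le (CX X) cx_star cx_mult (a n) (a (Suc n))"
    and sup: "is_sup_sa (CX X) cx_star cx_mult (range a) s"
  let ?one = "indicator (topspace X) :: 'x \<Rightarrow> complex"
  have one: "sa_el (CX X) cx_star ?one"
    by (intro sa_el_CX_projection is_projection_indicator) auto
  have one_CX: "?one \<in> CX X"
    using one by (simp add: sa_el_CX)
  have a_CX: "a n \<in> CX X" "Im (a n x) = 0" for n x
    using sa by (auto simp: sa_el_CX)
  have s: "sa_el (CX X) cx_star s"
    using sup by (simp add: is_sup_sa_def)
  have s_CX: "s \<in> CX X" "Im (s x) = 0" for x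
    using s by (auto simp: sa_el_CX)
  have le_s: "sa_le (CX X) cx_star cx_mult (a n) s" for n
    using sup by (auto simp: is_sup_sa_def)
  define gap where "gap n x = Re (s x) - Re (a n x)" for n x
  have gap_cont: "continuous_map X euclidean (gap n)" for n
    unfolding gap_def by (intro continuous_map_diff continuous_map_Re_CX a_CX s_CX)
  have gap_antimono: "gap n x \<le> gap m x" if "m \<le> n" for m n x
  proof -
    have "Re (a m x) \<le> Re (a n x)"
      using inc by (intro lift_Suc_mono_le[OF _ that, of "\<lambda>n. Re (a n x)"]) (simp add: sa_le_CX)
    then show ?thesis
      by (simp add: gap_def)
  qed
  \<comment> \<open>On the space \<open>s \<le> B0\<close>, since the constant \<open>B0\<close> is
    an upper bound, and \<open>a n \<ge> -B0\<close>. The extra 1 makes \<open>B\<close> positive,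
    for the later division.\<close>
  define B where "B = 2 * \<bar>B0\<bar> + 1"
  have B: "0 < B"
    by (simp add: B_def)
  have gap_bound: "gap n x \<le> B" if x: "x \<in> topspace X" for n x
  proof -
    define v where "v = (\<lambda>x. complex_of_real B0 * ?one x)"
    have v: "sa_el (CX X) cx_star v"
      using one by (auto simp: v_def sa_el_CX CX_cmult)
    have "Re (a n y) \<le> Re (v y)" for n y
    proof (cases "y \<in> topspace X")
      case True
      then show ?thesis
        using bdd complex_Re_le_cmod[of "a n y"] by (force simp: v_def intro: order_trans)
    next
      case False
      then show ?thesis
        using a_CX[of n] by (simp add: v_def CX_def)
    qed
    then have "sa_le (CX X) cx_star cx_mult s v"
      using sup sa v by (auto simp: is_sup_sa_def sa_le_CX)
    then have "Re (s x) \<le> Re (v x)"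
      by (simp add: sa_le_CX)
    moreover have "\<bar>Re (a n x)\<bar> \<le> B0"
      using bdd x abs_Re_le_cmod[of "a n x"] by (force intro: order_trans)
    ultimately show ?thesis
      using x by (simp add: gap_def B_def v_def)
  qed
  show "is_sup_sa UNIV cstar (*) (range (\<lambda>n. \<phi> (a n))) (\<phi> s)"
    unfolding is_sup_sa_def
  proof (intro conjI ballI allI impI)
    show phi_s: "sa_el UNIV cstar (\<phi> s)"
      by (simp add: sa_el_def positive_map_self_adjoint[OF pos s])
    show "sa_le UNIV cstar (*) t (\<phi> s)" if "t \<in> range (\<lambda>n. \<phi> (a n))" for t
      using that positive_map_mono[OF pos le_s] by auto
    fix u assume "sa_el UNIV cstar u \<and> (\<forall>t\<in>range (\<lambda>n. \<phi> (a n)). sa_le UNIV cstar (*) t u)"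
    then have u: "sa_el UNIV cstar u" and ub: "\<forall>t\<in>range (\<lambda>n. \<phi> (a n)). sa_le UNIV cstar (*) t u"
      by blast+
    have u_sa: "cstar u = u"
      using u by (simp add: sa_el_def)
    have one_sa: "cstar (\<phi> ?one) = \<phi> ?one"
      by (rule positive_map_self_adjoint[OF pos one])
    have "sa_square (u - \<phi> s)"
    proof (rule sa_square_archimedean)
      show "cstar (u - \<phi> s) = u - \<phi> s"
        using u_sa phi_s by (simp add: sa_el_def)
      fix e :: real assume e: "0 < e"
      \<comment> \<open>The two levels \<open>e/2\<close> and \<open>e\<close> leave room for a
        clopen set between a closed and an open sublevel set.\<close>
      have ex: "\<forall>n. \<exists>W. openin X W \<and> closedin X W \<and> {x \<in> topspace X. gap n x \<in> {..e/2}} \<subseteq> W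
          \<and> W \<subseteq> {x \<in> topspace X. gap n x \<in> {..<e}}"
      proof
        fix n
        have "closedin X {x \<in> topspace X. gap n x \<in> {..e/2}}"
          by (rule closedin_continuous_map_preimage[OF gap_cont]) simp
        moreover have "openin X {x \<in> topspace X. gap n x \<in> {..<e}}"
          by (rule openin_continuous_map_preimage[OF gap_cont]) simp
        moreover have "{x \<in> topspace X. gap n x \<in> {..e/2}} \<subseteq> {x \<in> topspace X. gap n x \<in> {..<e}}"
          using e by auto
        ultimately show "\<exists>W. openin X W \<and> closedin X W \<and> {x \<in> topspace X. gap n x \<in> {..e/2}} \<subseteq> W
            \<and> W \<subseteq> {x \<in> topspace X. gap n x \<in> {..<e}}"
          by (rule stone_space_clopen_between[OF X]) blast
      qed
      obtain W where "\<forall>n. openin X (W n) \<and> closedin X (W n) \<and> {x \<in> topspace X. gap n x \<in> {..e/2}} \<subseteq> W n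
          \<and> W n \<subseteq> {x \<in> topspace X. gap n x \<in> {..<e}}"
        using choice[OF ex] by (elim exE)
      then have W: "openin X (W n)" "closedin X (W n)"
        "{x \<in> topspace X. gap n x \<in> {..e/2}} \<subseteq> W n"
        "W n \<subseteq> {x \<in> topspace X. gap n x \<in> {..<e}}" for n
        by blast+
      \<comment> \<open>Disjointness gives orthogonal projections, while the union, and with it the
        covering property, is unchanged.\<close>
      define P where "P = disjointed W"
      have P_open: "openin X (P n)" and P_closed: "closedin X (P n)" for n
        unfolding P_def disjointed_def using W(1,2)
        by (auto intro!: openin_diff closedin_diff closedin_Union openin_Union)
      have P_disj: "disjoint_family P"
        unfolding P_def by (rule disjoint_family_disjointed)
      have P_cover: "(\<Union>n. P n) = (\<Union>n. W n)"
        unfolding P_def by (rule UN_disjointed_eq)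
      have "is_sup_sa (CX X) cx_star cx_mult
          {(\<lambda>x. \<Sum>i\<in>F. indicator (P i) x) | F :: nat set. finite F} ?one"
      proof (rule is_sup_partition_of_unity[OF X sup P_open P_closed P_disj])
        show "x \<in> (\<Union>n. P n)" if "x \<in> topspace X" "Re (s x) - Re (a n x) \<le> e / 2" for n x
          using that W(3)[of n] unfolding P_cover by (auto simp: gap_def)
      qed (use e in simp)
      moreover have "\<forall>n. is_projection (CX X) cx_star cx_mult (indicator (P n))"
        by (simp add: is_projection_indicator P_open P_closed)
      moreover have "\<forall>m n. m \<noteq> n \<longrightarrow> cx_mult (indicator (P m)) (indicator (P n)) = (\<lambda>x. 0)"
        using P_disj by (auto simp: cx_mult_def fun_eq_iff indicator_def disjoint_family_on_def)
      ultimately have sup1: "is_sup_sa UNIV cstar (*)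
          {(\<Sum>i\<in>F. \<phi> (indicator (P i))) | F :: nat set. finite F} (\<phi> ?one)"
        by (intro add[unfolded sigma_additive_proj_def, rule_format] conjI) simp_all
      \<comment> \<open>The element \<open>t\<close> is the bound on \<open>\<phi> q\<close>
        obtained by solving \<open>0 \<le> y + B (\<phi> 1 - \<phi> q)\<close>. It does not depend
        on \<open>F\<close>, so it also dominates the supremum \<open>\<phi> 1\<close>, which says
        \<open>0 \<le> y\<close>.\<close>
      define y where "y = u - \<phi> s + e *\<^sub>R \<phi> ?one"
      define t where "t = (1 / B) *\<^sub>R y + \<phi> ?one"
      have "cstar t = t"
        using phi_s by (simp add: t_def y_def u_sa one_sa sa_el_def)
      moreover have "sa_le UNIV cstar (*) (\<Sum>i\<in>F. \<phi> (indicator (P i))) t" if F: "finite F" for F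
      proof -
        obtain n where n: "F \<subseteq> {..n}"
          using F finite_nat_set_iff_bounded_le by (auto simp: subset_iff)
        define q :: "'x \<Rightarrow> complex" where "q = indicator (\<Union>i\<in>F. P i)"
        have "openin X (\<Union>i\<in>F. P i)" "closedin X (\<Union>i\<in>F. P i)"
          using P_open P_closed F by (auto intro!: closedin_Union openin_Union)
        then have q: "sa_el (CX X) cx_star q" and q_CX: "q \<in> CX X"
          unfolding q_def by (auto intro: sa_el_CX_projection is_projection_indicator CX_indicator)
        have "q = (\<lambda>x. \<Sum>i\<in>F. indicator (P i) x)"
          unfolding q_def fun_eq_iff
          using indicator_UN_disjoint[OF F] P_disj by (metis disjoint_family_on_mono subset_UNIV)
        then have phi_q: "(\<Sum>i\<in>F. \<phi> (indicator (P i))) = \<phi> q"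
          using positive_map_sum[OF pos F, of "\<lambda>i. indicator (P i)"]
          by (simp add: CX_indicator P_open P_closed)
        \<comment> \<open>Nonnegative because on the chosen \<open>P i\<close> one has
          \<open>q = 1\<close> and \<open>gap n \<le> e\<close>, while elsewhere on the space
          \<open>q = 0\<close> and \<open>gap n \<le> B\<close>.\<close>
        define f where "f = (\<lambda>x. (complex_of_real e * ?one x + complex_of_real B * (?one x - q x)) - (s x - a n x))"
        have f_CX: "f \<in> CX X"
          unfolding f_def by (intro CX_diff CX_add CX_cmult one_CX q_CX s_CX a_CX)
        have "Im (f x) = 0 \<and> 0 \<le> Re (f x)" for x
        proof (cases "x \<in> topspace X")
          case False
          then show ?thesis
            using f_CX by (simp add: CX_def)
        next
          case True
          \<comment> \<open>The gap is below \<open>e\<close> already at stage \<open>i\<close>, and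
            \<open>n\<close> was chosen above all of \<open>F\<close>.\<close>
          have "gap n x \<le> e" if "x \<in> P i" "i \<in> F" for i
          proof -
            have "x \<in> W i"
              using that disjointed_subset[of W i] by (auto simp: P_def)
            then have "gap i x < e"
              using W(4)[of i] by auto
            moreover have "gap n x \<le> gap i x"
              using n that by (intro gap_antimono) auto
            ultimately show ?thesis
              by simp
          qed
          then show ?thesis
            using True gap_bound[OF True, of n] e B
            by (auto simp: f_def q_def gap_def a_CX s_CX indicator_def)
        qed
        then have "sa_square (\<phi> f)"
          by (rule positive_map_pos[OF pos f_CX])
        moreover have "\<phi> f = e *\<^sub>R \<phi> ?one + B *\<^sub>R (\<phi> ?one - \<phi> q) - (\<phi> s - \<phi> (a n))"
          unfolding f_def
          by (simp add: positive_map_diff[OF pos] positive_map_add[OF pos] positive_map_scaleR[OF pos]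
              CX_diff CX_add CX_cmult one_CX q_CX s_CX a_CX)
        moreover have "sa_square (u - \<phi> (a n))"
          using ub by (auto simp: sa_le_UNIV)
        ultimately have "sa_square ((u - \<phi> (a n)) + (e *\<^sub>R \<phi> ?one + B *\<^sub>R (\<phi> ?one - \<phi> q) - (\<phi> s - \<phi> (a n))))"
          using sa_square_add[of "u - \<phi> (a n)" "\<phi> f"] by simp
        then have "sa_square (y + B *\<^sub>R (\<phi> ?one - \<phi> q))"
          by (simp add: y_def algebra_simps)
        then have "sa_square ((1 / B) *\<^sub>R (y + B *\<^sub>R (\<phi> ?one - \<phi> q)))"
          using B by (intro sa_square_scaleR) auto
        moreover have "(1 / B) *\<^sub>R (y + B *\<^sub>R (\<phi> ?one - \<phi> q)) = t - \<phi> q"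
          using B by (simp add: t_def scaleR_add_right)
        ultimately show ?thesis
          using \<open>cstar t = t\<close> positive_map_self_adjoint[OF pos q] by (simp add: phi_q sa_le_UNIV)
      qed
      ultimately have "sa_le UNIV cstar (*) (\<phi> ?one) t"
        using sup1 by (auto simp: is_sup_sa_def sa_el_def)
      then have "sa_square (B *\<^sub>R (t - \<phi> ?one))"
        using B by (intro sa_square_scaleR) (auto simp: sa_le_UNIV)
      then show "sa_square (u - \<phi> s + e *\<^sub>R \<phi> ?one)"
        using B by (simp add: t_def y_def)
    qed
    then show "sa_le UNIV cstar (*) (\<phi> s) u"
      using u_sa phi_s by (simp add: sa_le_UNIV sa_el_def)
  qed
qed

theorem theorem4p5:
  fixes X :: "'x topology" and \<phi> :: "('x \<Rightarrow> complex) \<Rightarrow> 'a::cstar_algebra"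
  assumes "stone_space X" and "positive_map X \<phi>"
  shows "sigma_normal X \<phi> \<longleftrightarrow> sigma_additive_proj X \<phi>"
  using sigma_additive_proj_if_sigma_normal[OF assms(2)]
    sigma_normal_if_sigma_additive_proj[OF assms] by blast

end
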